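(* Let $G=(V,E)$ be a locally finite random geometric graph with $V\subset\mathbb{R}$, whose law is invariant and ergodic under translations by $\mathbb{Z}$. If $$\sum_{k\ge 1}\mathbb{P}\big(\exists\, x\in V\cap[-2^k,2^k],\ y\in V:\ |x-y|\ge 2^k,\ \{x,y\}\in E\big)<\infty,$$ then almost surely every connected component of $G$ is recurrent.
   Context: A random geometric graph $G=(V,E)$ in $\mathbb{R}^d$ is a random graph with vertex set $V\subset\mathbb{R}^d$ and edge set $E$ consisting of unordered pairs of distinct elements of $V$. It is locally finite if, almost surely, $V\cap K$ is finite for every compact $K\subset\mathbb{R}^d$ and every vertex has finite graph degree. No independence of edges is assumed. Invariance and ergodicity under translations by $\mathbb{Z}$ (here $d=1$) mean that the law of $G$ is unchanged when all vertices (together with the edges between them) are shifted by an integer, and that every event invariant under these shifts has probability $0$ or $1$. Every graph is regarded as an electrical network with unit conductances. A connected component is recurrent if the effective resistance from one (equivalently every) vertex of that component to infinity is infinite (equivalently, simple random walk on it is recurrent); finite components are recurrent by convention. *)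

theory Defs
  imports "HOL-Probability.Probability"
begin

text \<open>A simple graph is a pair of a vertex set and a set of two-element sets of vertices.\<close>

type_synonym 'a graph = "'a set \<times> 'a set set"

abbreviation vertices :: "'a graph \<Rightarrow> 'a set" where "vertices \<equiv> fst"
abbreviation edges :: "'a graph \<Rightarrow> 'a set set" where "edges \<equiv> snd"

definition graphs :: "'a graph set" where
  "graphs = {(V, E). E \<subseteq> {{x, y} | x y. x \<in> V \<and> y \<in> V \<and> x \<noteq> y}}"

definition adjacency :: "'a graph \<Rightarrow> ('a \<times> 'a) set" where
  "adjacency g = {(x, y). {x, y} \<in> edges g}"

definition neighbours :: "'a graph \<Rightarrow> 'a \<Rightarrow> 'a set" where
  "neighbours g x = {y. {x, y} \<in> edges g}"

definition graph_component :: "'a graph \<Rightarrow> 'a \<Rightarrow> 'a set" where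
  "graph_component g x = {y. (x, y) \<in> (adjacency g)\<^sup>*}"

definition graph_components :: "'a graph \<Rightarrow> 'a set set" where
  "graph_components g = graph_component g ` vertices g"

definition locally_finite_graph :: "'a::euclidean_space graph \<Rightarrow> bool" where
  "locally_finite_graph g \<longleftrightarrow>
     (\<forall>K. compact K \<longrightarrow> finite (vertices g \<inter> K)) \<and>
     (\<forall>x\<in>vertices g. finite (neighbours g x))"


text \<open>Graphs in Euclidean space carry the sigma-algebra generated by the numbers of vertices in
  Borel sets and the numbers of edges, counted as ordered pairs of endpoints, in Borel sets of
  pairs. The number of points in a set may be infinite; the finite values generate.\<close>

definition graph_space :: "'a::euclidean_space graph measure" where
  "graph_space = sigma graphs
     ({{g \<in> graphs. finite (vertices g \<inter> B) \<and> card (vertices g \<inter> B) = n} | B n. B \<in> sets borel} \<union>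
      {{g \<in> graphs. finite (adjacency g \<inter> D) \<and> card (adjacency g \<inter> D) = n} | D n. D \<in> sets borel})"

definition random_geometric_graph :: "'w measure \<Rightarrow> ('w \<Rightarrow> 'a::euclidean_space graph) \<Rightarrow> bool" where
  "random_geometric_graph M G \<longleftrightarrow> prob_space M \<and> G \<in> measurable M graph_space"

definition shift_graph :: "'a::euclidean_space \<Rightarrow> 'a graph \<Rightarrow> 'a graph" where
  "shift_graph v g = ((+) v ` vertices g, (`) ((+) v) ` edges g)"

text \<open>The following two definitions concern a law, that is, a measure on \<^const>\<open>graph_space\<close>.\<close>

definition Z_invariant :: "real graph measure \<Rightarrow> bool" where
  "Z_invariant P \<longleftrightarrow> (\<forall>z::int. distr P graph_space (shift_graph (of_int z)) = P)"

definition Z_ergodic :: "real graph measure \<Rightarrow> bool" where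
  "Z_ergodic P \<longleftrightarrow>
     (\<forall>A\<in>sets P. (\<forall>z::int. shift_graph (of_int z) -` A \<inter> space P = A) \<longrightarrow>
        measure P A = 0 \<or> measure P A = 1)"


text \<open>Every edge has conductance 1. For a finite set \<open>W\<close> of vertices of the component of \<open>x\<close>, with
  \<open>x \<in> W\<close>, hold \<open>x\<close> at potential 1 and ground everything outside \<open>W\<close>; Kirchhoff's law holds at the
  remaining vertices. In a locally finite graph this determines the potential, since
  the component is connected and \<open>W\<close> is finite.\<close>

definition is_voltage :: "'a graph \<Rightarrow> 'a \<Rightarrow> 'a set \<Rightarrow> ('a \<Rightarrow> real) \<Rightarrow> bool" where
  "is_voltage g x W h \<longleftrightarrow>
     h x = 1 \<and> (\<forall>y. y \<notin> W \<longrightarrow> h y = 0) \<and>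
     (\<forall>y\<in>W - {x}. (\<Sum>z\<in>neighbours g y. h y - h z) = 0)"

definition voltage :: "'a graph \<Rightarrow> 'a \<Rightarrow> 'a set \<Rightarrow> 'a \<Rightarrow> real" where
  "voltage g x W = (THE h. is_voltage g x W h)"

text \<open>Voltage difference 1 over total current out of \<open>x\<close>; in \<^typ>\<open>ennreal\<close>, \<open>1 / 0 = \<infinity>\<close>.\<close>

definition eff_resistance :: "'a graph \<Rightarrow> 'a \<Rightarrow> 'a set \<Rightarrow> ennreal" where
  "eff_resistance g x W =
     1 / ennreal (\<Sum>y\<in>neighbours g x. voltage g x W x - voltage g x W y)"

text \<open>The resistance between \<open>x\<close> and the complement of \<open>W\<close> increases with \<open>W\<close> (Rayleigh), so the
  supremum is its limit along every exhaustion of the component by finite sets.\<close>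

definition eff_resistance_to_infinity :: "'a graph \<Rightarrow> 'a \<Rightarrow> ennreal" where
  "eff_resistance_to_infinity g x =
     (SUP W \<in> {W. finite W \<and> x \<in> W \<and> W \<subseteq> graph_component g x}. eff_resistance g x W)"

definition recurrent_component :: "'a graph \<Rightarrow> 'a set \<Rightarrow> bool" where
  "recurrent_component g C \<longleftrightarrow> finite C \<or> (\<forall>x\<in>C. eff_resistance_to_infinity g x = \<infinity>)"


text \<open>Shifts are measurable, so the push-forward in the definition of invariance is the
  intended one.\<close>

lemma space_graph_space [simp]: "space graph_space = graphs"
  unfolding graph_space_def by (rule space_measure_of) auto

lemma shift_graph_in_graphs:
  assumes "g \<in> graphs" shows "shift_graph v g \<in> graphs"
proof -
  have "\<exists>x y. e = {x, y} \<and> x \<in> (+) v ` vertices g \<and> y \<in> (+) v ` vertices g \<and> x \<noteq> y"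
    if "e \<in> (`) ((+) v) ` edges g" for e
  proof -
    from that assms obtain x y where "x \<in> vertices g" "y \<in> vertices g" "x \<noteq> y" "e = (+) v ` {x, y}"
      by (auto simp: graphs_def)
    then show ?thesis
      by (intro exI[of _ "v + x"] exI[of _ "v + y"]) auto
  qed
  then show ?thesis
    by (auto simp: graphs_def shift_graph_def)
qed

lemma adjacency_shift_graph:
  "adjacency (shift_graph v g) = (\<lambda>(x, y). (v + x, v + y)) ` adjacency g"
proof -
  have img: "(+) v ` {x, y} = {v + x, v + y}" for x y :: 'a by simp
  have inj: "inj ((`) ((+) v))"
    by (simp add: inj_def inj_image_eq_iff)
  have mem: "(v + x, v + y) \<in> adjacency (shift_graph v g) \<longleftrightarrow> (x, y) \<in> adjacency g" for x y
    unfolding adjacency_def shift_graph_def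
    by (simp only: mem_Collect_eq prod.case snd_conv img[symmetric] inj_image_mem_iff[OF inj])
  show ?thesis
  proof (intro set_eqI iffI)
    fix p assume p: "p \<in> adjacency (shift_graph v g)"
    obtain x y where "p = (v + x, v + y)"
      by (metis add.commute diff_add_cancel surj_pair)
    with p mem show "p \<in> (\<lambda>(x, y). (v + x, v + y)) ` adjacency g" by force
  next
    fix p assume "p \<in> (\<lambda>(x, y). (v + x, v + y)) ` adjacency g"
    with mem show "p \<in> adjacency (shift_graph v g)" by auto
  qed
qed

lemma measurable_shift_graph [measurable]:
  "shift_graph v \<in> measurable graph_space (graph_space :: 'a::euclidean_space graph measure)"
proof -
  let ?V = "\<lambda>B n. {g \<in> graphs. finite (vertices g \<inter> B) \<and> card (vertices g \<inter> B) = n}"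
  let ?E = "\<lambda>D n. {g \<in> graphs. finite (adjacency g \<inter> D) \<and> card (adjacency g \<inter> D) = n}"
  let ?A = "{?V B n | B n. B \<in> sets borel} \<union> {?E D n | D n. D \<in> sets borel} :: 'a graph set set"
  define s :: "'a \<times> 'a \<Rightarrow> 'a \<times> 'a" where "s = (\<lambda>(x, y). (v + x, v + y))"
  have inj: "inj s" by (auto simp: s_def inj_on_def)
  have A: "?A \<subseteq> Pow graphs" by auto
  have gen: "X \<in> sets graph_space" if "X \<in> ?A" for X :: "'a graph set"
    unfolding graph_space_def using sets_measure_of[OF A] sigma_sets.Basic[OF that] by simp
  have genV: "?V B n \<in> sets graph_space" if "B \<in> sets borel" for B :: "'a set" and n
    by (rule gen, rule UnI1, intro CollectI exI conjI) (rule refl that)+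
  have genE: "?E D n \<in> sets graph_space" if "D \<in> sets borel" for D :: "('a \<times> 'a) set" and n
    by (rule gen, rule UnI2, intro CollectI exI conjI) (rule refl that)+
  have card_eq: "finite (f ` S \<inter> T) \<and> card (f ` S \<inter> T) = n \<longleftrightarrow>
      finite (S \<inter> f -` T) \<and> card (S \<inter> f -` T) = n" if "inj f" for f :: "'c \<Rightarrow> 'd" and S T n
  proof -
    have "f ` S \<inter> T = f ` (S \<inter> f -` T)" by auto
    moreover have "inj_on f (S \<inter> f -` T)" using that by (rule inj_on_subset) simp
    ultimately show ?thesis by (simp add: finite_image_iff card_image)
  qed
  have "shift_graph v -` X \<inter> graphs \<in> sets graph_space" if X: "X \<in> ?A" for X :: "'a graph set"
    using X
  proof (elim UnE)
    assume "X \<in> {?V B n | B n. B \<in> sets borel}"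
    then obtain B n where B: "B \<in> sets borel" and X: "X = ?V B n" by blast
    have "shift_graph v -` X \<inter> graphs = ?V ((+) v -` B) n"
      unfolding X using shift_graph_in_graphs card_eq[of "(+) v"]
      by (auto simp: shift_graph_def)
    moreover have "(+) v -` B \<in> sets borel"
      using measurable_sets[of "(+) v" borel borel B] B by simp
    ultimately show ?thesis by (simp only: genV)
  next
    assume "X \<in> {?E D n | D n. D \<in> sets borel}"
    then obtain D n where D: "D \<in> sets borel" and X: "X = ?E D n" by blast
    have "shift_graph v -` X \<inter> graphs = ?E (s -` D) n"
      unfolding X using shift_graph_in_graphs card_eq[OF inj]
      by (auto simp: adjacency_shift_graph s_def)
    moreover have "s \<in> borel_measurable borel"
      unfolding s_def case_prod_beta
      by (intro borel_measurable_continuous_onI continuous_intros)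
    then have "s -` D \<in> sets borel"
      using measurable_sets[of s borel borel D] D by simp
    ultimately show ?thesis by (simp only: genE)
  qed
  note pre = this
  have "shift_graph v \<in> measurable graph_space (sigma graphs ?A)"
  proof (rule measurable_measure_of)
    show "?A \<subseteq> Pow graphs" by (rule A)
    show "shift_graph v \<in> space graph_space \<rightarrow> graphs" by (simp add: shift_graph_in_graphs)
    show "shift_graph v -` X \<inter> space graph_space \<in> sets graph_space" if "X \<in> ?A" for X
      using pre[OF that] by simp
  qed
  then show ?thesis by (simp only: graph_space_def)
qed

end

theory Submission
  imports Defs
begin

text \<open>Let \<open>N t\<close> be the number of edges that cross the point \<open>t\<close>. By Borel-Cantelli, almost surely
  for all large \<open>k\<close> no vertex of \<open>[-2^k, 2^k]\<close> has an edge of length at least \<open>2^k\<close>; comparing the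
  endpoint nearer to 0 with the dyadic scales, all edges that cross 0 then lie in a bounded
  interval, so \<open>N 0\<close> is finite. By Poincare recurrence for the shifts by 1 and -1, almost
  surely \<open>N n \<le> N 0\<close> for infinitely many positive and infinitely many negative integers \<open>n\<close>.
  Hence a component can be exhausted by intervals with disjoint edge boundaries of at most
  \<open>2 N 0\<close> edges, and the Nash-Williams criterion gives infinite resistance.\<close>

section \<open>Voltages\<close>

lemma mem_neighbours_iff: "z \<in> neighbours g y \<longleftrightarrow> (y, z) \<in> adjacency g"
  by (simp add: neighbours_def adjacency_def)

lemma adjacency_commute: "(y, z) \<in> adjacency g \<Longrightarrow> (z, y) \<in> adjacency g"
  by (simp add: adjacency_def insert_commute)

lemma voltage_exists:
  fixes g :: "'a graph"
  assumes "x \<in> W"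
  shows "\<exists>h. is_voltage g x W h"
proof -
  \<comment> \<open>Iterated averaging from 0 increases to a fixed point, which is the voltage.\<close>
  define T :: "('a \<Rightarrow> real) \<Rightarrow> 'a \<Rightarrow> real" where
    "T h y = (if y = x then 1 else if y \<in> W then (\<Sum>z\<in>neighbours g y. h z) / card (neighbours g y) else 0)"
    for h y
  define H where "H n = (T ^^ n) (\<lambda>_. 0)" for n
  have H_Suc: "H (Suc n) = T (H n)" for n by (simp add: H_def)
  have T_mono: "T h y \<le> T h' y" if "\<And>z. h z \<le> h' z" for h h' y
    using that by (auto simp: T_def intro!: divide_right_mono sum_mono)
  have H_range: "0 \<le> H n y \<and> H n y \<le> 1" for n y
  proof (induction n arbitrary: y)
    case 0 show ?case by (simp add: H_def)
  next
    case (Suc n)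
    have "(\<Sum>z\<in>neighbours g y. H n z) \<le> (\<Sum>z\<in>neighbours g y. 1)"
      using Suc by (intro sum_mono) auto
    then have "(\<Sum>z\<in>neighbours g y. H n z) / card (neighbours g y) \<le> 1"
      by (auto simp: divide_le_eq_1)
    moreover have "0 \<le> (\<Sum>z\<in>neighbours g y. H n z) / card (neighbours g y)"
      using Suc by (intro divide_nonneg_nonneg sum_nonneg) auto
    ultimately show ?case by (auto simp: H_Suc T_def)
  qed
  have H_mono: "H n y \<le> H (Suc n) y" for n y
  proof (induction n arbitrary: y)
    case 0 show ?case using H_range[of "Suc 0" y] by (simp add: H_def)
  next
    case (Suc n) then show ?case unfolding H_Suc by (rule T_mono)
  qed
  define L where "L y = lim (\<lambda>n. H n y)" for y
  have lim: "(\<lambda>n. H n y) \<longlonglongrightarrow> L y" for y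
  proof -
    have inc: "incseq (\<lambda>n. H n y)" by (intro incseq_SucI H_mono)
    have "\<forall>n. H n y \<le> 1" using H_range by simp
    then obtain l where "(\<lambda>n. H n y) \<longlonglongrightarrow> l" by (rule incseq_convergent[OF inc])
    then show ?thesis by (simp add: L_def limI)
  qed
  have "(\<lambda>n. T (H n) y) \<longlonglongrightarrow> T L y" for y
    unfolding T_def by (auto intro!: tendsto_intros lim simp: divide_inverse)
  moreover have "(\<lambda>n. T (H n) y) \<longlonglongrightarrow> L y" for y
    using LIMSEQ_Suc[OF lim[of y]] by (simp add: H_Suc)
  ultimately have fix_L: "L y = T L y" for y
    using LIMSEQ_unique by blast
  \<comment> \<open>An empty sum is 0, and so by convention is one over an infinite neighbour set;
    otherwise the fixed-point equation is multiplied by the degree.\<close>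
  have "(\<Sum>z\<in>neighbours g y. L y - L z) = 0" if y: "y \<in> W - {x}" for y
  proof (cases "finite (neighbours g y) \<and> neighbours g y \<noteq> {}")
    case True
    then have "card (neighbours g y) \<noteq> 0" by simp
    with y fix_L[of y] have "card (neighbours g y) * L y = (\<Sum>z\<in>neighbours g y. L z)"
      by (simp add: T_def)
    then show ?thesis by (simp add: sum_subtractf)
  qed auto
  moreover have "L x = 1" "\<And>y. y \<notin> W \<Longrightarrow> L y = 0"
    using fix_L assms by (auto simp: T_def)
  ultimately show ?thesis unfolding is_voltage_def by blast
qed

text \<open>A positive maximum over \<open>W\<close> would spread: where it is attained in
  \<open>W - {x}\<close>, harmonicity forces every neighbour to attain it too. Following a path to
  \<open>x\<close> contradicts \<open>d x \<le> 0\<close>.\<close>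

lemma maximum_principle:
  fixes d :: "'a \<Rightarrow> real"
  assumes fin: "finite W" and nbrs: "\<And>y. y \<in> W \<Longrightarrow> finite (neighbours g y)"
    and conn: "W \<subseteq> graph_component g x"
    and bdry: "d x \<le> 0" "\<And>y. y \<notin> W \<Longrightarrow> d y \<le> 0"
    and harm: "\<And>y. y \<in> W - {x} \<Longrightarrow> (\<Sum>z\<in>neighbours g y. d y - d z) = 0"
  shows "d y \<le> 0"
proof (rule ccontr)
  assume pos: "\<not> d y \<le> 0"
  with bdry have y: "y \<in> W" by auto
  define m where "m = Max (d ` W)"
  have "d y \<le> m" using y fin by (simp add: m_def)
  then have "m > 0" using pos by simp
  have le_m: "d z \<le> m" for z
    using fin bdry(2)[of z] \<open>m > 0\<close> by (cases "z \<in> W") (auto simp: m_def)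
  obtain v where v: "v \<in> W" "d v = m"
    using Max_in[of "d ` W"] fin y unfolding m_def by fastforce
  \<comment> \<open>The induction walks back from \<open>v\<close> towards \<open>x\<close>. The
    path stays in \<open>W\<close>, because the visited values equal \<open>m > 0\<close> while
    \<open>d\<close> is nonpositive outside \<open>W\<close>.\<close>
  have "(x, v) \<in> (adjacency g)\<^sup>*" using conn v by (auto simp: graph_component_def)
  then have "d x = m"
  proof (induction rule: converse_rtrancl_induct)
    case base show ?case by (rule v)
  next
    case (step u w)
    then have w: "w \<in> W - {x}" using bdry \<open>m > 0\<close> by force
    have u: "u \<in> neighbours g w" using step(1) by (simp add: mem_neighbours_iff adjacency_commute)
    have "\<forall>z\<in>neighbours g w. d w - d z = 0"
      using harm[OF w] nbrs[of w] w le_m step.IH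
      by (subst (asm) sum_nonneg_eq_0_iff) auto
    with u step.IH show ?case by auto
  qed
  with bdry \<open>m > 0\<close> show False by simp
qed

text \<open>Both differences of two voltages obey the maximum principle. This is what makes the
  definite description in \<open>voltage\<close> meaningful.\<close>

lemma is_voltage_unique:
  assumes fin: "finite W" and nbrs: "\<And>y. y \<in> W \<Longrightarrow> finite (neighbours g y)"
    and conn: "W \<subseteq> graph_component g x"
    and h: "is_voltage g x W h" and h': "is_voltage g x W h'"
  shows "h = h'"
proof
  have le: "a y - b y \<le> 0" if a: "is_voltage g x W a" and b: "is_voltage g x W b" for a b y
  proof (rule maximum_principle[OF fin nbrs conn])
    fix y assume "y \<in> W - {x}"
    then have "(\<Sum>z\<in>neighbours g y. a y - a z) - (\<Sum>z\<in>neighbours g y. b y - b z) = 0"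
      using a b by (simp add: is_voltage_def)
    then show "(\<Sum>z\<in>neighbours g y. (a y - b y) - (a z - b z)) = 0"
      unfolding sum_subtractf by simp
  qed (use a b in \<open>auto simp: is_voltage_def\<close>)
  fix y show "h y = h' y" using le[OF h h', of y] le[OF h' h, of y] by simp
qed

lemma is_voltage_voltage:
  assumes "finite W" "\<And>y. y \<in> W \<Longrightarrow> finite (neighbours g y)"
    "W \<subseteq> graph_component g x" "x \<in> W"
  shows "is_voltage g x W (voltage g x W)"
proof -
  obtain h where "is_voltage g x W h" using voltage_exists[OF assms(4)] ..
  then show ?thesis unfolding voltage_def
    by (metis is_voltage_unique[OF assms(1-3)] theI)
qed

section \<open>Energy\<close>

lemma finite_incident_edges:
  assumes "finite W" "\<And>y. y \<in> W \<Longrightarrow> finite (neighbours g y)"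
  shows "finite {(y, z) \<in> adjacency g. y \<in> W \<or> z \<in> W}"
proof -
  have "{(y, z) \<in> adjacency g. y \<in> W \<or> z \<in> W} \<subseteq>
      Sigma W (neighbours g) \<union> (Sigma W (neighbours g))\<inverse>"
    using adjacency_commute[of _ _ g] by (auto simp: mem_neighbours_iff)
  moreover have "finite (Sigma W (neighbours g))" using assms by (intro finite_SigmaI) auto
  ultimately show ?thesis by (meson finite_UnI finite_converse finite_subset)
qed

text \<open>Summation by parts. The right-hand sum runs over ordered pairs, so each edge occurs
  twice; hence the factor 2.\<close>

lemma discrete_Green:
  fixes f h :: "'a \<Rightarrow> real"
  assumes fin: "finite W" and nbrs: "\<And>y. y \<in> W \<Longrightarrow> finite (neighbours g y)"
    and f: "\<And>y. y \<notin> W \<Longrightarrow> f y = 0"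
  shows "2 * (\<Sum>y\<in>W. f y * (\<Sum>z\<in>neighbours g y. h y - h z)) =
    (\<Sum>(y, z) \<in> {(y, z) \<in> adjacency g. y \<in> W \<or> z \<in> W}. (f y - f z) * (h y - h z))"
proof -
  define D where "D = {(y, z) \<in> adjacency g. y \<in> W \<or> z \<in> W}"
  have finD: "finite D" unfolding D_def by (rule finite_incident_edges[OF fin nbrs])
  have "(\<Sum>y\<in>W. f y * (\<Sum>z\<in>neighbours g y. h y - h z)) =
      (\<Sum>(y, z) \<in> Sigma W (neighbours g). f y * (h y - h z))"
    using fin nbrs by (simp add: sum_distrib_left sum.Sigma)
  \<comment> \<open>The added pairs start outside \<open>W\<close>, where \<open>f\<close>
    vanishes.\<close>
  also have "\<dots> = (\<Sum>(y, z) \<in> D. f y * (h y - h z))"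
    using finD f by (intro sum.mono_neutral_left) (auto simp: D_def mem_neighbours_iff, blast)
  finally have 1: "(\<Sum>y\<in>W. f y * (\<Sum>z\<in>neighbours g y. h y - h z)) =
      (\<Sum>(y, z) \<in> D. f y * (h y - h z))" .
  have 2: "(\<Sum>(y, z) \<in> D. f y * (h y - h z)) = (\<Sum>(y, z) \<in> D. f z * (h z - h y))"
    by (rule sum.reindex_bij_witness[of _ prod.swap prod.swap])
      (auto simp: D_def dest: adjacency_commute)
  have "2 * (\<Sum>(y, z) \<in> D. f y * (h y - h z)) =
      (\<Sum>(y, z) \<in> D. f y * (h y - h z)) + (\<Sum>(y, z) \<in> D. f z * (h z - h y))"
    using 2 by simp
  also have "\<dots> = (\<Sum>(y, z) \<in> D. (f y - f z) * (h y - h z))"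
    by (simp add: sum.distrib[symmetric] case_prod_unfold algebra_simps)
  finally show ?thesis unfolding 1 D_def .
qed

text \<open>The upper half of Dirichlet's principle: the energy of any trial potential
  \<open>f\<close> bounds the effective conductance from above.\<close>

lemma current_le_energy:
  fixes f h :: "'a \<Rightarrow> real"
  assumes fin: "finite W" and nbrs: "\<And>y. y \<in> W \<Longrightarrow> finite (neighbours g y)" and x: "x \<in> W"
    and h: "is_voltage g x W h" and f: "f x = 1" "\<And>y. y \<notin> W \<Longrightarrow> f y = 0"
  shows "2 * (\<Sum>y\<in>neighbours g x. h x - h y) \<le>
    (\<Sum>(y, z) \<in> {(y, z) \<in> adjacency g. y \<in> W \<or> z \<in> W}. (f y - f z)\<^sup>2)" (is "2 * ?i \<le> _")
proof -
  define D where "D = {(y, z) \<in> adjacency g. y \<in> W \<or> z \<in> W}"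
  \<comment> \<open>Green's formula with a trial function \<open>k\<close>: harmonicity of
    \<open>h\<close> leaves only the term at \<open>x\<close>, where \<open>k x = 1\<close>.\<close>
  have energy: "2 * ?i = (\<Sum>(y, z) \<in> D. (k y - k z) * (h y - h z))"
    if k: "k x = 1" "\<And>y. y \<notin> W \<Longrightarrow> k y = 0" for k
  proof -
    have "(\<Sum>y\<in>W. k y * (\<Sum>z\<in>neighbours g y. h y - h z)) =
        (\<Sum>y\<in>W. if y = x then ?i else 0)"
      using h k by (intro sum.cong) (auto simp: is_voltage_def)
    also have "\<dots> = ?i" using fin x by simp
    finally show ?thesis
      using discrete_Green[where W = W and f = k and h = h and g = g, OF fin nbrs k(2)] unfolding D_def by simp
  qed
  \<comment> \<open>The current is also the energy of \<open>h\<close>, so AM-GM for \<open>f\<close> and \<open>h\<close> bounds it by that of \<open>f\<close>.\<close>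
  have "4 * ?i = 2 * (\<Sum>(y, z) \<in> D. (f y - f z) * (h y - h z))"
    using energy[of f, OF f] by linarith
  also have "\<dots> = (\<Sum>(y, z) \<in> D. 2 * ((f y - f z) * (h y - h z)))"
    by (simp add: sum_distrib_left case_prod_unfold)
  also have "\<dots> \<le> (\<Sum>(y, z) \<in> D. (f y - f z)\<^sup>2 + (h y - h z)\<^sup>2)"
  proof (intro sum_mono, clarsimp)
    fix y z
    show "2 * ((f y - f z) * (h y - h z)) \<le> (f y - f z)\<^sup>2 + (h y - h z)\<^sup>2"
      using sum_squares_bound[of "f y - f z" "h y - h z"] by (simp only: mult.assoc)
  qed
  also have "\<dots> = (\<Sum>(y, z) \<in> D. (f y - f z)\<^sup>2) + 2 * ?i"
    using energy[of h] h
    by (simp add: is_voltage_def sum.distrib case_prod_unfold power2_eq_square)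
  finally show ?thesis unfolding D_def by simp
qed

section \<open>Nash-Williams criterion\<close>

text \<open>Averaging the indicators of \<open>S 0\<close>, ..., \<open>S n\<close> gives a trial
  potential that changes only along cut edges, and there by \<open>1 / (n + 1)\<close>, since
  \<open>step\<close> makes the cuts disjoint. With at most \<open>c\<close> edges per cut its
  energy, each edge counted once, is at most \<open>c / (n + 1)\<close>, so the resistance grows at
  least linearly in \<open>n\<close>.\<close>

lemma Nash_Williams:
  fixes g :: "'a graph" and S :: "nat \<Rightarrow> 'a set"
  assumes fin: "\<And>j. finite (S j)" and nbrs: "\<And>y. y \<in> graph_component g x \<Longrightarrow> finite (neighbours g y)"
    and x: "x \<in> S 0" and conn: "\<And>j. S j \<subseteq> graph_component g x"
    and S_mono: "\<And>j. S j \<subseteq> S (Suc j)"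
    and step: "\<And>j y. y \<in> S j \<Longrightarrow> neighbours g y \<subseteq> S (Suc j)"
    and cut: "\<And>j. card {(y, z) \<in> adjacency g. y \<in> S j \<and> z \<notin> S j} \<le> c"
  shows "eff_resistance_to_infinity g x = \<infinity>"
proof -
  have mono: "S i \<subseteq> S j" if "i \<le> j" for i j
    using S_mono that by (rule lift_Suc_mono_le)
  have xS: "x \<in> S j" for j using mono[of 0 j] x by auto
  have nbrsS: "finite (neighbours g y)" if "y \<in> S j" for y j
    using nbrs conn that by blast
  \<comment> \<open>\<open>Suc c\<close> instead of \<open>c\<close> keeps the denominator positive
    when the cuts are empty.\<close>
  have bound: "ennreal (real (Suc n) / real (Suc c)) \<le> eff_resistance g x (S n)" for n
  proof -
    define h where "h = voltage g x (S n)"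
    have h: "is_voltage g x (S n) h"
      unfolding h_def by (intro is_voltage_voltage fin conn xS nbrsS)
    define i where "i = (\<Sum>y\<in>neighbours g x. h x - h y)"
    define f :: "'a \<Rightarrow> real" where "f y = (\<Sum>j\<le>n. indicator (S j) y) / Suc n" for y
    define D where "D = {(y, z) \<in> adjacency g. y \<in> S n \<or> z \<in> S n}"
    have finD: "finite D" unfolding D_def by (intro finite_incident_edges fin nbrsS)
    define B where "B j = {(y, z) \<in> adjacency g. y \<in> S j \<and> z \<notin> S j}" for j
    have BD: "B j \<subseteq> D" if "j \<le> n" for j
      using mono[OF that] by (auto simp: B_def D_def)
    \<comment> \<open>The two indicators account for the two orientations in which an edge may leave
      \<open>S j\<close>.\<close>
    have f_diff: "(f y - f z)\<^sup>2 \<le> (\<Sum>j\<le>n. indicator (B j) (y, z) + indicator (B j) (z, y)) / (real (Suc n))\<^sup>2"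
      if yz: "(y, z) \<in> adjacency g" for y z
    proof -
      \<comment> \<open>Disjointness of the cuts: an edge leaves at most one \<open>S j\<close>.\<close>
      define e :: "nat \<Rightarrow> real" where "e j = indicator (S j) y - indicator (S j) z" for j
      have nb: "y \<in> S (Suc j)" if "z \<in> S j" for j
        using step[OF that] adjacency_commute[OF yz] by (auto simp: mem_neighbours_iff)
      have nb': "z \<in> S (Suc j)" if "y \<in> S j" for j
        using step[OF that] yz by (auto simp: mem_neighbours_iff)
      have e0: "e j = 0 \<or> e k = 0" if "j < k" for j k
        using nb[of j] nb'[of j] mono[of "Suc j" k] mono[of j k] that
        by (auto simp: e_def indicator_def)
      have "(\<Sum>j\<le>n. e j)\<^sup>2 = (\<Sum>j\<le>n. (e j)\<^sup>2)"
      proof -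
        have "(\<Sum>j\<le>n. e j)\<^sup>2 = (\<Sum>j\<le>n. \<Sum>k\<le>n. e j * e k)"
          by (simp add: power2_eq_square sum_product)
        also have "\<dots> = (\<Sum>j\<le>n. \<Sum>k\<le>n. if j = k then (e j)\<^sup>2 else 0)"
        proof (intro sum.cong refl)
          fix j k show "e j * e k = (if j = k then (e j)\<^sup>2 else 0)"
            using e0[of j k] e0[of k j]
            by (cases j k rule: linorder_cases) (auto simp: power2_eq_square)
        qed
        also have "\<dots> = (\<Sum>j\<le>n. (e j)\<^sup>2)" by simp
        finally show ?thesis .
      qed
      also have "\<dots> = (\<Sum>j\<le>n. indicator (B j) (y, z) + indicator (B j) (z, y))"
        using yz adjacency_commute[OF yz] by (intro sum.cong) (auto simp: e_def B_def indicator_def)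
      finally have "(\<Sum>j\<le>n. e j)\<^sup>2 = (\<Sum>j\<le>n. indicator (B j) (y, z) + indicator (B j) (z, y))" .
      moreover have "f y - f z = (\<Sum>j\<le>n. e j) / Suc n"
        by (simp add: f_def e_def sum_subtractf diff_divide_distrib)
      ultimately show ?thesis by (simp add: power_divide)
    qed
    have B_sum: "(\<Sum>p\<in>D. indicator (B j) p) \<le> real c"
        "(\<Sum>p\<in>D. indicator (B j) (prod.swap p)) \<le> real c" if "j \<le> n" for j
    proof -
      have *: "(\<Sum>p\<in>D. indicator (B j) p) = real (card (B j))"
        using finD BD[OF that] by (simp add: indicator_def sum.If_cases Int_absorb1 Int_def[symmetric])
      then show "(\<Sum>p\<in>D. indicator (B j) p) \<le> real c"
        using cut[of j] by (simp add: B_def)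
      also have "(\<Sum>p\<in>D. indicator (B j) p :: real) = (\<Sum>p\<in>D. indicator (B j) (prod.swap p))"
        by (rule sum.reindex_bij_witness[of _ prod.swap prod.swap])
          (auto simp: D_def dest: adjacency_commute)
      finally show "(\<Sum>p\<in>D. indicator (B j) (prod.swap p)) \<le> real c" .
    qed
    have "2 * i \<le> (\<Sum>(y, z) \<in> D. (f y - f z)\<^sup>2)"
      unfolding i_def D_def
    proof (rule current_le_energy[OF fin nbrsS xS h])
      show "f x = 1" using xS by (simp add: f_def)
      show "f y = 0" if "y \<notin> S n" for y
      proof -
        have "indicator (S j) y = (0::real)" if "j \<le> n" for j
          using mono[OF that] \<open>y \<notin> S n\<close> by (auto simp: indicator_def)
        then show ?thesis by (simp add: f_def)
      qed
    qed
    also have "\<dots> \<le> (\<Sum>p\<in>D. (\<Sum>j\<le>n. indicator (B j) p + indicator (B j) (prod.swap p)) / (Suc n)\<^sup>2)"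
      using f_diff by (intro sum_mono) (auto simp: D_def)
    also have "\<dots> = (\<Sum>j\<le>n. (\<Sum>p\<in>D. indicator (B j) p) + (\<Sum>p\<in>D. indicator (B j) (prod.swap p))) / (real (Suc n))\<^sup>2"
      by (simp add: sum_divide_distrib[symmetric] sum.swap[of _ D] sum.distrib)
    also have "\<dots> \<le> (\<Sum>j\<le>n. real c + real c) / (real (Suc n))\<^sup>2"
      using B_sum by (intro divide_right_mono sum_mono add_mono) auto
    also have "\<dots> = 2 * (c / Suc n)" by (simp add: power2_eq_square divide_simps)
    finally have i_le: "i \<le> c / Suc n" by simp
    have "ennreal (Suc n / Suc c) \<le> 1 / ennreal i"
    \<comment> \<open>For \<open>i \<le> 0\<close> the truncation \<open>ennreal i\<close> is 0, and
      the resistance is \<open>1 / 0 = \<infinity>\<close>.\<close>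
    proof (cases "i \<le> 0")
      case True
      then have "ennreal i = 0" by (rule ennreal_neg)
      then show ?thesis by (simp only: ennreal_divide_zero) simp
    next
      case False
      have "c / real (Suc n) \<le> Suc c / real (Suc n)" by (intro divide_right_mono) auto
      with i_le have "i \<le> Suc c / real (Suc n)" by linarith
      then have "Suc n / Suc c \<le> 1 / i"
        using False by (simp add: field_simps)
      then have "ennreal (Suc n / Suc c) \<le> ennreal (1 / i)" by (rule ennreal_leI)
      also have "\<dots> = 1 / ennreal i"
        using False by (subst ennreal_1[symmetric], subst divide_ennreal) auto
      finally show ?thesis .
    qed
    then show ?thesis unfolding eff_resistance_def i_def h_def .
  qed
  have le: "eff_resistance g x (S n) \<le> eff_resistance_to_infinity g x" for n
    unfolding eff_resistance_to_infinity_def using fin conn xS by (intro SUP_upper) auto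
  show ?thesis
  proof (rule ccontr)
    assume "eff_resistance_to_infinity g x \<noteq> \<infinity>"
    then obtain r where r: "eff_resistance_to_infinity g x = ennreal r" "0 \<le> r"
      by (cases "eff_resistance_to_infinity g x") auto
    obtain n where n: "r * Suc c < real n" using reals_Archimedean2 by blast
    have "ennreal (Suc n / Suc c) \<le> ennreal r" using bound le r(1) order_trans by metis
    then have "Suc n / Suc c \<le> r" using r(2) by simp
    with n show False by (simp add: field_simps)
  qed
qed

section \<open>Graphs on the line\<close>

text \<open>Listing the left endpoint first counts each edge once and exhibits the crossings as the
  adjacency pairs in a Borel rectangle, whose counts generate \<open>graph_space\<close>. An
  endpoint at \<open>t\<close> itself counts as left.\<close>

definition crossing :: "real graph \<Rightarrow> real \<Rightarrow> (real \<times> real) set" where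
  "crossing g t = adjacency g \<inter> ({..t} \<times> {t<..})"

lemma adjacency_vertices:
  assumes "g \<in> graphs" "(y, z) \<in> adjacency g"
  shows "y \<in> vertices g" "z \<in> vertices g"
  using assms by (auto simp: graphs_def adjacency_def doubleton_eq_iff)

lemma graph_component_subset_vertices:
  assumes "g \<in> graphs" "x \<in> vertices g"
  shows "graph_component g x \<subseteq> vertices g"
proof
  fix y assume "y \<in> graph_component g x"
  then have "(x, y) \<in> (adjacency g)\<^sup>*" by (simp add: graph_component_def)
  then show "y \<in> vertices g"
    by (induction rule: rtrancl_induct) (auto intro: assms dest: adjacency_vertices(2)[OF assms(1)])
qed

text \<open>Intervals whose two ends have few crossings cut the component in at most
  \<open>2 c\<close> edges. They can be chosen one after another, each containing the previous piece
  of the component with all its neighbours, as Nash-Williams requires.\<close>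

lemma recurrent_if_frequent_small_crossings:
  fixes g :: "real graph"
  assumes g: "g \<in> graphs" and lf: "locally_finite_graph g" and x: "x \<in> vertices g"
    and right: "\<exists>\<^sub>\<infinity>n. finite (crossing g (real n)) \<and> card (crossing g (real n)) \<le> c"
    and left: "\<exists>\<^sub>\<infinity>n. finite (crossing g (- real n)) \<and> card (crossing g (- real n)) \<le> c"
  shows "eff_resistance_to_infinity g x = \<infinity>"
proof -
  define K where "K = graph_component g x"
  have KV: "K \<subseteq> vertices g"
    unfolding K_def by (rule graph_component_subset_vertices[OF g x])
  have K_step: "z \<in> K" if "y \<in> K" "(y, z) \<in> adjacency g" for y z
    using that unfolding K_def graph_component_def by (auto intro: rtrancl_into_rtrancl)
  \<comment> \<open>Half-open to match \<open>crossing\<close>: an edge leaving the interval on the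
    right crosses its right end, and one leaving on the left crosses its left end.\<close>
  define I where "I p = {- real (fst p)<..real (snd p)}" for p :: "nat \<times> nat"
  define good where "good p \<longleftrightarrow> finite (crossing g (- real (fst p))) \<and> card (crossing g (- real (fst p))) \<le> c
      \<and> finite (crossing g (real (snd p))) \<and> card (crossing g (real (snd p))) \<le> c" for p
  have good_ex: "\<exists>p. good p \<and> F \<subseteq> I p" if "finite F" for F :: "real set"
  proof -
    obtain r where r: "\<And>y. y \<in> F \<Longrightarrow> \<bar>y\<bar> \<le> r"
      using finite_imp_bounded[OF \<open>finite F\<close>] unfolding bounded_iff by auto
    obtain m :: nat where m: "r < real m" using reals_Archimedean2 by blast
    obtain a where a: "a > m" "finite (crossing g (- real a))" "card (crossing g (- real a)) \<le> c"
      using left unfolding INFM_nat by blast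
    obtain b where b: "b > m" "finite (crossing g (real b))" "card (crossing g (real b)) \<le> c"
      using right unfolding INFM_nat by blast
    have "F \<subseteq> I (a, b)"
    proof
      fix y assume "y \<in> F"
      then have "\<bar>y\<bar> < real m" using r m by force
      then show "y \<in> I (a, b)" using a(1) b(1) by (auto simp: I_def)
    qed
    with a b show ?thesis by (intro exI[of _ "(a, b)"]) (auto simp: good_def)
  qed
  have nbrs: "finite (neighbours g y)" if "y \<in> K" for y
    using lf that KV by (auto simp: locally_finite_graph_def)
  have fin: "finite (K \<inter> I p)" for p
  proof (rule finite_subset)
    show "K \<inter> I p \<subseteq> vertices g \<inter> {- real (fst p)..real (snd p)}"
      using KV by (auto simp: I_def)
    show "finite (vertices g \<inter> {- real (fst p)..real (snd p)})"
      using lf by (auto simp: locally_finite_graph_def)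
  qed
  \<comment> \<open>Local finiteness makes each piece and its neighbourhood finite, so
    \<open>good_ex\<close> supplies the next interval.\<close>
  obtain P where P: "\<And>n. good (P n) \<and> x \<in> I (P n)"
    "\<And>n. K \<inter> I (P n) \<union> (\<Union>y\<in>K \<inter> I (P n). neighbours g y) \<subseteq> I (P (Suc n))"
  proof -
    have "\<exists>P. \<forall>n. (good (P n) \<and> x \<in> I (P n)) \<and>
        K \<inter> I (P n) \<union> (\<Union>y\<in>K \<inter> I (P n). neighbours g y) \<subseteq> I (P (Suc n))"
    proof (rule dependent_nat_choice)
      show "\<exists>p. good p \<and> x \<in> I p" using good_ex[of "{x}"] by auto
      fix p and n :: nat assume "good p \<and> x \<in> I p"
      let ?F = "insert x (K \<inter> I p \<union> (\<Union>y\<in>K \<inter> I p. neighbours g y))"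
      have "finite ?F" using fin[of p] nbrs by auto
      from good_ex[OF this] show "\<exists>q. (good q \<and> x \<in> I q) \<and>
          K \<inter> I p \<union> (\<Union>y\<in>K \<inter> I p. neighbours g y) \<subseteq> I q"
        by (metis insert_subset)
    qed
    then show ?thesis using that by blast
  qed
  show ?thesis
  proof (rule Nash_Williams)
    fix j
    show "finite (K \<inter> I (P j))" by (rule fin)
    show "finite (neighbours g y)" if "y \<in> graph_component g x" for y
      using nbrs that by (simp add: K_def)
    show "x \<in> K \<inter> I (P 0)" using P(1) by (simp add: K_def graph_component_def)
    show "K \<inter> I (P j) \<subseteq> graph_component g x" by (simp add: K_def)
    show "K \<inter> I (P j) \<subseteq> K \<inter> I (P (Suc j))" using P(2)[of j] by blast
    show "neighbours g y \<subseteq> K \<inter> I (P (Suc j))" if "y \<in> K \<inter> I (P j)" for y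
      using P(2)[of j] that K_step by (auto simp: mem_neighbours_iff)
    let ?A = "crossing g (real (snd (P j)))" and ?B = "(crossing g (- real (fst (P j))))\<inverse>"
    \<comment> \<open>\<open>K\<close> is closed under edges, so such an edge leaves the interval
      itself. The converse restores the order of endpoints at the left end.\<close>
    have "{(y, z) \<in> adjacency g. y \<in> K \<inter> I (P j) \<and> z \<notin> K \<inter> I (P j)} \<subseteq> ?A \<union> ?B"
      using K_step by (auto simp: crossing_def I_def dest: adjacency_commute)
    moreover have "finite ?A" "finite ?B" using P(1)[of j] by (auto simp: good_def)
    ultimately have "card {(y, z) \<in> adjacency g. y \<in> K \<inter> I (P j) \<and> z \<notin> K \<inter> I (P j)} \<le> card (?A \<union> ?B)"
      by (intro card_mono) auto
    also have "\<dots> \<le> card ?A + card ?B" by (rule card_Un_le)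
    also have "\<dots> \<le> c + c" using P(1)[of j] by (auto simp: good_def intro: add_mono)
    finally show "card {(y, z) \<in> adjacency g. y \<in> K \<inter> I (P j) \<and> z \<notin> K \<inter> I (P j)} \<le> c + c" .
  qed
qed

lemma finite_crossing_0:
  assumes g: "g \<in> graphs" and lf: "locally_finite_graph g"
    and ev: "\<forall>\<^sub>F k in sequentially. \<not> (\<exists>x \<in> vertices g \<inter> {- (2 ^ k) .. 2 ^ k}. \<exists>y \<in> vertices g.
              \<bar>x - y\<bar> \<ge> 2 ^ k \<and> {x, y} \<in> edges g)"
  shows "finite (crossing g 0)"
proof -
  obtain K where K: "\<And>k x y. k \<ge> K \<Longrightarrow> (x, y) \<in> adjacency g \<Longrightarrow> \<bar>x\<bar> \<le> 2 ^ k \<Longrightarrow> \<bar>x - y\<bar> < 2 ^ k"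
  proof -
    obtain K where K: "\<And>k. k \<ge> K \<Longrightarrow> \<not> (\<exists>x \<in> vertices g \<inter> {- (2 ^ k) .. 2 ^ k}. \<exists>y \<in> vertices g.
              \<bar>x - y\<bar> \<ge> 2 ^ k \<and> {x, y} \<in> edges g)"
      using ev unfolding eventually_sequentially by blast
    show ?thesis
    proof (rule that[of K], rule ccontr)
      fix k x y assume *: "k \<ge> K" "(x, y) \<in> adjacency g" "\<bar>x\<bar> \<le> 2 ^ k" "\<not> \<bar>x - y\<bar> < 2 ^ k"
      then have "x \<in> vertices g \<inter> {- (2 ^ k) .. 2 ^ k}" "y \<in> vertices g" "{x, y} \<in> edges g"
        using adjacency_vertices[OF g *(2)] by (auto simp: adjacency_def)
      with K[OF *(1)] *(4) show False by (meson not_less)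
    qed
  qed
  \<comment> \<open>If the nearer endpoint \<open>y\<close> were beyond \<open>2^K\<close>, the least \<open>k\<close> with \<open>\<bar>y\<bar> \<le> 2^k\<close> would satisfy
    \<open>2^k < 2 * \<bar>y\<bar> \<le> \<bar>y - z\<bar>\<close>.\<close>
  have near: "\<bar>y\<bar> \<le> 2 ^ K \<and> \<bar>z\<bar> \<le> 2 ^ K"
    if yz: "(y, z) \<in> adjacency g" and opp: "y \<le> 0 \<and> 0 \<le> z \<or> z \<le> 0 \<and> 0 \<le> y" and le: "\<bar>y\<bar> \<le> \<bar>z\<bar>" for y z
  proof (cases "\<bar>y\<bar> \<le> 2 ^ K")
    \<comment> \<open>The endpoints lie on opposite sides of 0, so
      \<open>\<bar>z\<bar> \<le> \<bar>y - z\<bar> < 2 ^ K\<close>.\<close>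
    case True
    then show ?thesis using K[OF order_refl yz True] opp by auto
  next
    case False
    obtain k0 :: nat where "\<bar>y\<bar> < 2 ^ k0" using real_arch_pow[of 2 "\<bar>y\<bar>"] by auto
    then have k0: "\<bar>y\<bar> \<le> 2 ^ k0" by simp
    define k where "k = (LEAST k. \<bar>y\<bar> \<le> 2 ^ k)"
    have k: "\<bar>y\<bar> \<le> 2 ^ k" unfolding k_def by (rule LeastI[of _ k0]) (rule k0)
    have "K < k"
    proof (rule ccontr)
      assume "\<not> K < k"
      then have "(2::real) ^ k \<le> 2 ^ K" by (intro power_increasing) auto
      with k False show False by simp
    qed
    then obtain l where l: "k = Suc l" by (cases k) auto
    have "\<not> \<bar>y\<bar> \<le> 2 ^ l" using not_less_Least[of l "\<lambda>k. \<bar>y\<bar> \<le> 2 ^ k"] l by (simp add: k_def)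
    moreover have "\<bar>y - z\<bar> < 2 ^ k" using K[of k, OF _ yz k] \<open>K < k\<close> by simp
    ultimately have False using opp le l by auto
    then show ?thesis ..
  qed
  have "crossing g 0 \<subseteq> (vertices g \<inter> {- (2 ^ K) .. 2 ^ K}) \<times> (vertices g \<inter> {- (2 ^ K) .. 2 ^ K})"
  proof
    fix p assume "p \<in> crossing g 0"
    then obtain y z where p: "p = (y, z)" "(y, z) \<in> adjacency g" "y \<le> 0" "0 < z"
      by (auto simp: crossing_def)
    \<comment> \<open>\<open>near\<close> is applied to whichever endpoint is closer to 0.\<close>
    have "\<bar>y\<bar> \<le> 2 ^ K \<and> \<bar>z\<bar> \<le> 2 ^ K"
      using near[of y z] near[of z y] p adjacency_commute[OF p(2)] by linarith
    then show "p \<in> (vertices g \<inter> {- (2 ^ K) .. 2 ^ K}) \<times> (vertices g \<inter> {- (2 ^ K) .. 2 ^ K})"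
      using adjacency_vertices[OF g p(2)] p(1) by (auto simp: abs_le_iff)
  qed
  moreover have "finite (vertices g \<inter> {- (2 ^ K) .. 2 ^ K})"
    using lf by (auto simp: locally_finite_graph_def)
  ultimately show ?thesis by (meson finite_SigmaI finite_subset)
qed

section \<open>Recurrence under shifts\<close>

lemma (in finite_measure) Poincare_recurrence:
  assumes T: "T \<in> measurable M M"
    and inv: "\<And>B. B \<in> sets M \<Longrightarrow> emeasure M (T -` B \<inter> space M) = emeasure M B"
    and A: "A \<in> sets M"
  shows "AE x in M. x \<in> A \<longrightarrow> (\<exists>\<^sub>\<infinity>n. (T ^^ n) x \<in> A)"
proof -
  have Tn [measurable]: "(T ^^ n) \<in> measurable M M" for n
    using T by (rule measurable_compose_n)
  note [measurable] = A
  \<comment> \<open>The last visits to \<open>A\<close>: the sets \<open>C n\<close> are disjoint and equally large, hence null.\<close>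
  define B where "B = {x \<in> space M. x \<in> A \<and> (\<forall>n. (T ^^ Suc n) x \<notin> A)}"
  have B: "B \<in> sets M" unfolding B_def by measurable
  define C where "C n = (T ^^ n) -` B \<inter> space M" for n
  have C: "C n \<in> sets M" for n unfolding C_def using Tn B by (rule measurable_sets)
  have eC: "emeasure M (C n) = emeasure M B" for n
  proof (induction n)
    case 0 show ?case using sets.sets_into_space[OF B] by (simp add: C_def Int_absorb2)
  next
    case (Suc n)
    have "C (Suc n) = T -` C n \<inter> space M"
      using measurable_space[OF T] by (auto simp: C_def funpow_swap1)
    with inv[OF C] Suc show ?case by simp
  qed
  \<comment> \<open>A point of \<open>C m\<close> never visits \<open>A\<close> after time
    \<open>m\<close>, whereas a point of \<open>C n\<close> does so at time
    \<open>n\<close>.\<close>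
  have disj: "C m \<inter> C n = {}" if "m < n" for m n
  proof -
    obtain d where d: "n = Suc d + m" using less_imp_Suc_add[OF \<open>m < n\<close>] by (auto simp: add.commute)
    have "(T ^^ n) x = (T ^^ Suc d) ((T ^^ m) x)" for x
      unfolding d funpow_add by simp
    then show ?thesis by (auto simp: C_def B_def simp del: funpow.simps)
  qed
  have disjoint: "disjoint_family C"
    unfolding disjoint_family_on_def using disj by (metis Int_commute linorder_neqE_nat)
  \<comment> \<open>The measures of the disjoint sets \<open>C n\<close> form a convergent series
    with constant terms.\<close>
  have "measure M B = 0"
  proof -
    have "(\<lambda>n. measure M (C n)) sums measure M (\<Union>n. C n)"
      using C disjoint by (intro finite_measure_UNION) auto
    then have "(\<lambda>n. measure M (C n)) \<longlonglongrightarrow> 0" by (intro summable_LIMSEQ_zero sums_summable)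
    moreover have "measure M (C n) = measure M B" for n using eC[of n] by (simp add: measure_def)
    ultimately show ?thesis by (simp add: LIMSEQ_const_iff)
  qed
  then have "emeasure M (C n) = 0" for n unfolding eC by (simp add: emeasure_eq_measure)
  then have "AE x in M. x \<notin> C n" for n using C by (intro AE_not_in null_setsI) auto
  then have "AE x in M. \<forall>n. x \<notin> C n" by (simp add: AE_all_countable)
  \<comment> \<open>A point of \<open>A\<close> with only finitely many visits has a last one, at
    time \<open>m\<close>, and so lies in \<open>C m\<close>.\<close>
  moreover have "\<exists>\<^sub>\<infinity>n. (T ^^ n) x \<in> A" if x: "\<forall>n. x \<notin> C n" "x \<in> A" for x
  proof (rule ccontr)
    assume "\<not> (\<exists>\<^sub>\<infinity>n. (T ^^ n) x \<in> A)"
    then have fin: "finite {n. (T ^^ n) x \<in> A}" by (simp add: INFM_iff_infinite)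
    have xM: "x \<in> space M" using x(2) sets.sets_into_space[OF A] by auto
    define m where "m = Max {n. (T ^^ n) x \<in> A}"
    have "0 \<in> {n. (T ^^ n) x \<in> A}" using x by simp
    then have m: "(T ^^ m) x \<in> A" using Max_in[OF fin] unfolding m_def by blast
    have "(T ^^ Suc n) ((T ^^ m) x) \<notin> A" for n
    proof
      assume "(T ^^ Suc n) ((T ^^ m) x) \<in> A"
      then have "(T ^^ (Suc n + m)) x \<in> A" unfolding funpow_add by simp
      then have "Suc n + m \<le> m" unfolding m_def using fin by (intro Max_ge) auto
      then show False by simp
    qed
    then have "x \<in> C m"
      using m xM measurable_space[OF Tn xM] by (simp add: C_def B_def del: funpow.simps)
    with x show False by blast
  qed
  ultimately show ?thesis by (auto elim: eventually_mono)
qed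

section \<open>Equivariance and measurability of crossing counts\<close>

lemma shift_graph_zero: "shift_graph 0 g = g"
  by (simp add: shift_graph_def)

lemma shift_graph_add: "shift_graph u (shift_graph v g) = shift_graph (u + v) g"
  by (simp add: shift_graph_def image_image add.assoc)

lemma funpow_shift_graph: "(shift_graph v ^^ n) g = shift_graph (of_nat n *\<^sub>R v) g"
  by (induction n) (simp_all add: shift_graph_zero shift_graph_add scaleR_left_distrib)

lemma
  shows finite_crossing_shift_graph: "finite (crossing (shift_graph v g) t) \<longleftrightarrow> finite (crossing g (t - v))"
    and card_crossing_shift_graph: "card (crossing (shift_graph v g) t) = card (crossing g (t - v))"
proof -
  let ?s = "\<lambda>(x, y). (v + x, v + y)"
  have "crossing (shift_graph v g) t = ?s ` crossing g (t - v)"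
    by (auto simp: crossing_def adjacency_shift_graph)
  moreover have "inj_on ?s (crossing g (t - v))" by (auto simp: inj_on_def)
  ultimately show "finite (crossing (shift_graph v g) t) \<longleftrightarrow> finite (crossing g (t - v))"
    "card (crossing (shift_graph v g) t) = card (crossing g (t - v))"
    by (simp_all add: finite_image_iff card_image)
qed

lemma sets_graph_space_adjacency_count:
  assumes "D \<in> sets borel"
  shows "{g \<in> graphs. finite (adjacency g \<inter> D) \<and> card (adjacency g \<inter> D) = n} \<in> sets graph_space"
proof -
  have "{g \<in> graphs. finite (adjacency g \<inter> D) \<and> card (adjacency g \<inter> D) = n} \<in>
     {{g \<in> graphs. finite (vertices g \<inter> B) \<and> card (vertices g \<inter> B) = n} | B n. B \<in> sets borel} \<union>
     {{g \<in> graphs. finite (adjacency g \<inter> D) \<and> card (adjacency g \<inter> D) = n} | D n. D \<in> sets borel}"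
    using assms by blast
  then show ?thesis unfolding graph_space_def by (subst sets_measure_of) (auto intro: sigma_sets.Basic)
qed

lemma sets_graph_space_crossing:
  "{g \<in> graphs. finite (crossing g t) \<and> card (crossing g t) \<le> c} \<in> sets graph_space"
proof -
  have "{..t} \<times> {t<..} \<in> sets (borel :: (real \<times> real) measure)"
    unfolding borel_prod[symmetric] by (intro pair_measureI) auto
  then have "(\<Union>n\<le>c. {g \<in> graphs. finite (crossing g t) \<and> card (crossing g t) = n}) \<in> sets graph_space"
    unfolding crossing_def by (intro sets.finite_UN sets_graph_space_adjacency_count) auto
  also have "(\<Union>n\<le>c. {g \<in> graphs. finite (crossing g t) \<and> card (crossing g t) = n}) =
      {g \<in> graphs. finite (crossing g t) \<and> card (crossing g t) \<le> c}" by auto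
  finally show ?thesis .
qed

text \<open>Poincare recurrence for the event of at most \<open>c\<close> crossings at 0. The shift
  is by \<open>- z\<close>, because its \<open>n\<close>-th iterate carries the point
  \<open>z * n\<close> to 0.\<close>

lemma AE_frequent_small_crossings:
  assumes P: "prob_space P" "sets P = sets graph_space" and inv: "Z_invariant P"
  shows "AE g in P. \<forall>c. finite (crossing g 0) \<and> card (crossing g 0) \<le> c \<longrightarrow>
    (\<exists>\<^sub>\<infinity>n. finite (crossing g (of_int z * real n)) \<and> card (crossing g (of_int z * real n)) \<le> c)"
proof -
  interpret prob_space P by (rule P)
  let ?T = "shift_graph (- of_int z :: real)"
  have space: "space P = graphs" using sets_eq_imp_space_eq[OF P(2)] by simp
  have T: "?T \<in> measurable P graph_space"
    using measurable_shift_graph measurable_cong_sets[OF P(2) refl] by blast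
  then have T': "?T \<in> measurable P P"
    using measurable_cong_sets[OF refl P(2)] by blast
  have "distr P graph_space ?T = P"
    using inv[unfolded Z_invariant_def, rule_format, of "- z"] by simp
  then have pres: "emeasure P (?T -` B \<inter> space P) = emeasure P B" if "B \<in> sets P" for B
    using emeasure_distr[OF T, of B] that P(2) by simp
  have "AE g in P. finite (crossing g 0) \<and> card (crossing g 0) \<le> c \<longrightarrow>
    (\<exists>\<^sub>\<infinity>n. finite (crossing g (of_int z * real n)) \<and> card (crossing g (of_int z * real n)) \<le> c)" for c
  proof -
    have "{g \<in> graphs. finite (crossing g 0) \<and> card (crossing g 0) \<le> c} \<in> sets P"
      using sets_graph_space_crossing P(2) by simp
    with T' pres have "AE g in P. g \<in> {g \<in> graphs. finite (crossing g 0) \<and> card (crossing g 0) \<le> c} \<longrightarrow>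
        (\<exists>\<^sub>\<infinity>n. (?T ^^ n) g \<in> {g \<in> graphs. finite (crossing g 0) \<and> card (crossing g 0) \<le> c})"
      by (rule Poincare_recurrence)
    from this AE_space show ?thesis
      by eventually_elim (simp add: space shift_graph_in_graphs funpow_shift_graph
          finite_crossing_shift_graph card_crossing_shift_graph mult.commute)
  qed
  \<comment> \<open>There are countably many bounds \<open>c\<close>, so a single null set serves
    them all.\<close>
  then show ?thesis by (simp add: AE_all_countable)
qed

section \<open>Almost sure recurrence of every component\<close>

theorem corollary2p2:
  fixes M :: "'w measure" and G :: "'w \<Rightarrow> real graph"
  assumes "random_geometric_graph M G"
    and "AE \<omega> in M. locally_finite_graph (G \<omega>)"
    and "Z_invariant (distr M graph_space G)"
    and "Z_ergodic (distr M graph_space G)"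
    and "(\<lambda>k. measure M {\<omega> \<in> space M.
            \<exists>x \<in> vertices (G \<omega>) \<inter> {- (2 ^ k) .. 2 ^ k}. \<exists>y \<in> vertices (G \<omega>).
              \<bar>x - y\<bar> \<ge> 2 ^ k \<and> {x, y} \<in> edges (G \<omega>)}) summable_on {1::nat..}"
  shows "AE \<omega> in M. \<forall>C \<in> graph_components (G \<omega>). recurrent_component (G \<omega>) C"
proof -
  interpret prob_space M using assms(1) by (simp add: random_geometric_graph_def)
  have G: "G \<in> measurable M graph_space" using assms(1) by (simp add: random_geometric_graph_def)
  have G_graphs: "G \<omega> \<in> graphs" if "\<omega> \<in> space M" for \<omega>
    using measurable_space[OF G that] by simp
  define long where "long k g \<longleftrightarrow> (\<exists>x \<in> vertices g \<inter> {- (2 ^ k) .. 2 ^ k}. \<exists>y \<in> vertices g.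
              \<bar>x - y\<bar> \<ge> 2 ^ k \<and> {x, y} \<in> edges g)" for k and g :: "real graph"
  \<comment> \<open>The hypothesis sums from \<open>k = 1\<close>; the empty event at
    \<open>k = 0\<close> extends the series to all naturals for Borel-Cantelli.\<close>
  define A where "A k = (if k \<ge> 1 then {\<omega> \<in> space M. long k (G \<omega>)} else {})" for k :: nat
  \<comment> \<open>A long edge exists exactly when the adjacency relation meets the closed set
    \<open>D\<close>, so the event is the complement of a zero count, which is a generator.\<close>
  have long_event: "{\<omega> \<in> space M. long k (G \<omega>)} \<in> sets M" for k
  proof -
    define D :: "(real \<times> real) set" where "D = {(x, y). \<bar>x\<bar> \<le> 2 ^ k \<and> 2 ^ k \<le> \<bar>x - y\<bar>}"
    have "closed D" unfolding D_def case_prod_beta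
      by (intro closed_Collect_conj closed_Collect_le continuous_intros)
    then have "{g \<in> graphs. finite (adjacency g \<inter> D) \<and> card (adjacency g \<inter> D) = 0} \<in> sets graph_space"
      by (intro sets_graph_space_adjacency_count borel_closed)
    then have "G -` {g \<in> graphs. finite (adjacency g \<inter> D) \<and> card (adjacency g \<inter> D) = 0} \<inter> space M \<in> sets M"
      by (rule measurable_sets[OF G])
    then have "space M - G -` {g \<in> graphs. finite (adjacency g \<inter> D) \<and> card (adjacency g \<inter> D) = 0} \<inter> space M \<in> sets M"
      by (rule sets.compl_sets)
    also have "space M - G -` {g \<in> graphs. finite (adjacency g \<inter> D) \<and> card (adjacency g \<inter> D) = 0} \<inter> space M
        = {\<omega> \<in> space M. long k (G \<omega>)}"
    proof -
      have "long k g \<longleftrightarrow> adjacency g \<inter> D \<noteq> {}" if "g \<in> graphs" for g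
      proof
        assume "long k g"
        then obtain x y where "\<bar>x\<bar> \<le> 2 ^ k" "\<bar>x - y\<bar> \<ge> 2 ^ k" "{x, y} \<in> edges g"
          unfolding long_def by (metis Int_iff abs_le_iff atLeastAtMost_iff minus_le_iff)
        then have "(x, y) \<in> adjacency g \<inter> D" by (simp add: adjacency_def D_def)
        then show "adjacency g \<inter> D \<noteq> {}" by blast
      next
        assume "adjacency g \<inter> D \<noteq> {}"
        then obtain x y where xy: "(x, y) \<in> adjacency g" "\<bar>x\<bar> \<le> 2 ^ k" "\<bar>x - y\<bar> \<ge> 2 ^ k"
          by (auto simp: D_def)
        then have "x \<in> vertices g \<inter> {- (2 ^ k) .. 2 ^ k}" "y \<in> vertices g" "{x, y} \<in> edges g"
          using adjacency_vertices[OF that xy(1)] by (auto simp: adjacency_def)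
        with xy(3) show "long k g" unfolding long_def by blast
      qed
      with G_graphs show ?thesis by (fastforce simp: card_eq_0_iff)
    qed
    finally show ?thesis .
  qed
  have A: "A k \<in> sets M" for k using long_event by (simp add: A_def)
  have "(\<lambda>k. measure M (A k)) summable_on UNIV"
    using assms(5) unfolding long_def[symmetric]
    by (subst summable_on_cong_neutral[where T = "{1..}" and g = "\<lambda>k. measure M {\<omega> \<in> space M. long k (G \<omega>)}"])
      (auto simp: A_def)
  then have "summable (\<lambda>k. measure M (A k))" by (rule summable_on_imp_summable)
  then have "AE \<omega> in M. \<forall>\<^sub>F k in sequentially. \<omega> \<in> space M - A k"
    using A by (intro borel_cantelli_AE1) (auto simp: emeasure_eq_measure)
  then have long_AE: "AE \<omega> in M. \<forall>\<^sub>F k in sequentially. \<not> long k (G \<omega>)"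
  proof eventually_elim
    fix \<omega> assume "\<forall>\<^sub>F k in sequentially. \<omega> \<in> space M - A k"
    with eventually_ge_at_top[of 1] show "\<forall>\<^sub>F k in sequentially. \<not> long k (G \<omega>)"
      by eventually_elim (auto simp: A_def)
  qed
  \<comment> \<open>Recurrence holds for the law of \<open>G\<close> and is pulled back to
    \<open>M\<close>.\<close>
  have crossings: "AE \<omega> in M. \<forall>c. finite (crossing (G \<omega>) 0) \<and> card (crossing (G \<omega>) 0) \<le> c \<longrightarrow>
    (\<exists>\<^sub>\<infinity>n. finite (crossing (G \<omega>) (of_int z * real n)) \<and> card (crossing (G \<omega>) (of_int z * real n)) \<le> c)" for z
    using prob_space_distr[OF G] assms(3)
    by (intro AE_distrD[OF G] AE_frequent_small_crossings) auto
  show ?thesis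
    using long_AE crossings[of 1] crossings[of "-1"] assms(2) AE_space
  proof eventually_elim
    fix \<omega>
    let ?N = "\<lambda>t c. finite (crossing (G \<omega>) t) \<and> card (crossing (G \<omega>) t) \<le> c"
    assume ev: "\<forall>\<^sub>F k in sequentially. \<not> long k (G \<omega>)"
      and right: "\<forall>c. ?N 0 c \<longrightarrow> (\<exists>\<^sub>\<infinity>n. ?N (of_int 1 * real n) c)"
      and left: "\<forall>c. ?N 0 c \<longrightarrow> (\<exists>\<^sub>\<infinity>n. ?N (of_int (- 1) * real n) c)"
      and lf: "locally_finite_graph (G \<omega>)" and \<omega>: "\<omega> \<in> space M"
    have g: "G \<omega> \<in> graphs" by (rule G_graphs[OF \<omega>])
    have fin: "finite (crossing (G \<omega>) 0)"
      using ev unfolding long_def by (rule finite_crossing_0[OF g lf])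
    \<comment> \<open>This bound depends on the sample point, which is allowed because
      \<open>c\<close> is quantified inside the almost sure statements.\<close>
    define c where "c = card (crossing (G \<omega>) 0)"
    have "\<exists>\<^sub>\<infinity>n. ?N (real n) c" "\<exists>\<^sub>\<infinity>n. ?N (- real n) c"
      using right left fin by (auto simp: c_def)
    then have "eff_resistance_to_infinity (G \<omega>) x = \<infinity>" if "x \<in> vertices (G \<omega>)" for x
      by (rule recurrent_if_frequent_small_crossings[OF g lf that])
    moreover have "C \<subseteq> vertices (G \<omega>)" if "C \<in> graph_components (G \<omega>)" for C
      using that graph_component_subset_vertices[OF g] by (auto simp: graph_components_def)
    ultimately show "\<forall>C \<in> graph_components (G \<omega>). recurrent_component (G \<omega>) C"
      unfolding recurrent_component_def by blast
  qed
qed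

end
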